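(* Let $X=(\mathbb{Z}[\mathrm{i}])^3\backslash(\mathbb{C}^3,* )$ be the Iwasawa manifold. Then any small complex deformation of $X$ cannot be tamed by any symplectic form; that is, for every sufficiently small $\mathbf t\in\mathbb{C}^6$ and every symplectic form $\omega$ on the differentiable manifold underlying $X$, the complex structure $J_{\mathbf t}$ of the small deformation $X_{\mathbf t}$ is not $\omega$-tamed.
   Context: **Iwasawa manifold.** On $\mathbb{C}^3$ consider the group law $(z_1,z_2,z_3)*(w_1,w_2,w_3)=(z_1+w_1,\,z_2+w_2,\,z_3+z_1w_2+w_3)$. Then $(\mathbb{Z}[\mathrm{i}])^3$ is a cocompact discrete subgroup, and the Iwasawa manifold is the compact complex $3$-fold $X=(\mathbb{Z}[\mathrm{i}])^3\backslash(\mathbb{C}^3,* )$ (quotient by left translations), with complex structure induced by the coordinates $z^1,z^2,z^3$ of $\mathbb{C}^3$. **Small deformations (Nakamura).** For $\mathbf t=(t_{11},t_{12},t_{21},t_{22},t_{31},t_{32})\in\mathbb{C}^6$ put $D(\mathbf t)=t_{11}t_{22}-t_{12}t_{21}$ and $A(\bar{\mathbf z})=\frac12\left(t_{11}t_{21}\bar z^1\bar z^1+2t_{11}t_{22}\bar z^1\bar z^2+t_{12}t_{22}\bar z^2\bar z^2\right)$. For $\mathbf t$ in a sufficiently small ball around $\mathbf 0$, $X_{\mathbf t}$ is the differentiable manifold underlying $X$ endowed with the integrable almost-complex structure $J_{\mathbf t}$ whose lift to the universal cover $\mathbb{C}^3$ has holomorphic coordinates $$\zeta^1_{\mathbf t}=z^1+\sum_{j=1}^2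 t_{1j}\bar z^j,\qquad \zeta^2_{\mathbf t}=z^2+\sum_{j=1}^2 t_{2j}\bar z^j,\qquad \zeta^3_{\mathbf t}=z^3+\sum_{j=1}^2(t_{3j}+t_{2j}z^1)\bar z^j+A(\bar{\mathbf z})-D(\mathbf t)\bar z^3 .$$ By Nakamura, these are the small deformations of $X$ (and $X_{\mathbf 0}=X$). **Tamed.** An almost-complex structure $J$ on a manifold $M$ is $\omega$-tamed, for a symplectic form $\omega$ on $M$, if $\omega(v,Jv)>0$ for every nonzero tangent vector $v$. *)

theory Defs
  imports "HOL-Analysis.Analysis"
begin

primrec Ck :: "nat \<Rightarrow> ('a::euclidean_space \<Rightarrow> real) \<Rightarrow> bool" where
  "Ck 0 f \<longleftrightarrow> continuous_on UNIV f"
| "Ck (Suc k) f \<longleftrightarrow> (\<forall>x. f differentiable (at x)) \<and>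
     (\<forall>v. Ck k (\<lambda>x. frechet_derivative f (at x) v))"

definition smooth :: "('a::euclidean_space \<Rightarrow> real) \<Rightarrow> bool" where
  "smooth f \<longleftrightarrow> (\<forall>k. Ck k f)"

text \<open>A differential 2-form \<open>\<beta>\<close> on a Euclidean space is given by its values \<open>\<beta> z u v\<close>
  on tangent vectors \<open>u\<close>, \<open>v\<close> at the point \<open>z\<close>. The vectors \<open>u\<close>, \<open>v\<close>, \<open>w\<close> below are constant
  vector fields, so the bracket terms in the formula for the exterior derivative vanish.\<close>

definition ext_deriv2 ::
  "('a::euclidean_space \<Rightarrow> 'a \<Rightarrow> 'a \<Rightarrow> real) \<Rightarrow> 'a \<Rightarrow> 'a \<Rightarrow> 'a \<Rightarrow> 'a \<Rightarrow> real" where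
  "ext_deriv2 \<beta> z u v w =
     frechet_derivative (\<lambda>x. \<beta> x v w) (at z) u
   - frechet_derivative (\<lambda>x. \<beta> x u w) (at z) v
   + frechet_derivative (\<lambda>x. \<beta> x u v) (at z) w"

definition iw_mult :: "complex^3 \<Rightarrow> complex^3 \<Rightarrow> complex^3" (infixl "\<star>" 70) where
  "z \<star> w = vector [z$1 + w$1, z$2 + w$2, z$3 + z$1 * w$2 + w$3]"

definition gauss_int :: "complex set" where
  "gauss_int = {c. Re c \<in> \<int> \<and> Im c \<in> \<int>}"

definition iw_lattice :: "(complex^3) set" where
  "iw_lattice = {g. \<forall>i. g$i \<in> gauss_int}"

definition iw_proj :: "complex^3 \<Rightarrow> (complex^3) set" where
  "iw_proj z = (\<lambda>g. g \<star> z) ` iw_lattice"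

definition iwasawa :: "(complex^3) set set" where
  "iwasawa = range iw_proj"

text \<open>The lattice acts on \<open>\<complex>\<^sup>3\<close> freely and properly discontinuously, so \<open>iw_proj\<close> is a
  covering and a local diffeomorphism for the quotient structure, and the tangent bundle of the
  quotient is the quotient of the tangent bundle \<open>\<complex>\<^sup>3 \<times> \<complex>\<^sup>3\<close> by the differentials of the left
  translations. The class \<open>iw_dproj z v\<close> is the image of the tangent vector \<open>v\<close> at \<open>z\<close> under the
  differential of \<open>iw_proj\<close>.\<close>

definition iw_dproj :: "complex^3 \<Rightarrow> complex^3 \<Rightarrow> ((complex^3) \<times> (complex^3)) set" where
  "iw_dproj z v = (\<lambda>g. (g \<star> z, frechet_derivative (\<lambda>x. g \<star> x) (at z) v)) ` iw_lattice"

definition iw_tangent :: "(complex^3) set \<Rightarrow> ((complex^3) \<times> (complex^3)) set set" where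
  "iw_tangent p = {iw_dproj z v | z v. iw_proj z = p}"

definition iw_tangent_zero :: "(complex^3) set \<Rightarrow> ((complex^3) \<times> (complex^3)) set" where
  "iw_tangent_zero p = {(z, 0) | z. z \<in> p}"

text \<open>A 2-form \<open>\<omega>\<close> on the quotient assigns to a point \<open>p\<close> and two tangent vectors at \<open>p\<close> a real
  number; its values elsewhere are irrelevant. Its expression in the local coordinates
  \<open>z\<^sup>1, z\<^sup>2, z\<^sup>3\<close>, which are local inverses of \<open>iw_proj\<close>, is the following pullback. As
  \<open>v \<mapsto> iw_dproj z v\<close> is a linear isomorphism onto the tangent space at \<open>iw_proj z\<close>, bilinearity
  can be read off from it, and smoothness and the exterior derivative are local.\<close>

type_synonym iw_form2 =
  "(complex^3) set \<Rightarrow> ((complex^3) \<times> (complex^3)) set \<Rightarrow> ((complex^3) \<times> (complex^3)) set \<Rightarrow> real"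

definition iw_pullback :: "iw_form2 \<Rightarrow> complex^3 \<Rightarrow> complex^3 \<Rightarrow> complex^3 \<Rightarrow> real" where
  "iw_pullback \<omega> z u v = \<omega> (iw_proj z) (iw_dproj z u) (iw_dproj z v)"

definition iw_smooth_form2 :: "iw_form2 \<Rightarrow> bool" where
  "iw_smooth_form2 \<omega> \<longleftrightarrow>
     (\<forall>z. bilinear (iw_pullback \<omega> z)) \<and>
     (\<forall>p\<in>iwasawa. \<forall>\<tau>\<in>iw_tangent p. \<omega> p \<tau> \<tau> = 0) \<and>
     (\<forall>u v. smooth (\<lambda>z. iw_pullback \<omega> z u v))"

definition iw_closed :: "iw_form2 \<Rightarrow> bool" where
  "iw_closed \<omega> \<longleftrightarrow> (\<forall>z u v w. ext_deriv2 (iw_pullback \<omega>) z u v w = 0)"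

definition iw_nondegenerate :: "iw_form2 \<Rightarrow> bool" where
  "iw_nondegenerate \<omega> \<longleftrightarrow>
     (\<forall>p\<in>iwasawa. \<forall>\<sigma>\<in>iw_tangent p.
        (\<forall>\<tau>\<in>iw_tangent p. \<omega> p \<sigma> \<tau> = 0) \<longrightarrow> \<sigma> = iw_tangent_zero p)"

definition iw_symplectic :: "iw_form2 \<Rightarrow> bool" where
  "iw_symplectic \<omega> \<longleftrightarrow> iw_smooth_form2 \<omega> \<and> iw_closed \<omega> \<and> iw_nondegenerate \<omega>"

definition iw_tamed ::
  "iw_form2 \<Rightarrow> (((complex^3) \<times> (complex^3)) set \<Rightarrow> ((complex^3) \<times> (complex^3)) set) \<Rightarrow> bool" where
  "iw_tamed \<omega> J \<longleftrightarrow>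
     (\<forall>p\<in>iwasawa. \<forall>\<tau>\<in>iw_tangent p. \<tau> \<noteq> iw_tangent_zero p \<longrightarrow> \<omega> p \<tau> (J \<tau>) > 0)"

definition def_D :: "complex^2^3 \<Rightarrow> complex" where
  "def_D t = t$1$1 * t$2$2 - t$1$2 * t$2$1"

text \<open>The arguments \<open>a\<close>, \<open>b\<close> of \<open>def_A\<close> stand for the conjugate coordinates.\<close>

definition def_A :: "complex^2^3 \<Rightarrow> complex \<Rightarrow> complex \<Rightarrow> complex" where
  "def_A t a b = 1/2 * (t$1$1 * t$2$1 * (a * a) + 2 * t$1$1 * t$2$2 * (a * b)
                          + t$1$2 * t$2$2 * (b * b))"

definition def_zeta :: "complex^2^3 \<Rightarrow> complex^3 \<Rightarrow> complex^3" where
  "def_zeta t z = vector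
     [z$1 + (t$1$1 * cnj (z$1) + t$1$2 * cnj (z$2)),
      z$2 + (t$2$1 * cnj (z$1) + t$2$2 * cnj (z$2)),
      z$3 + ((t$3$1 + t$2$1 * z$1) * cnj (z$1) + (t$3$2 + t$2$2 * z$1) * cnj (z$2))
        + def_A t (cnj (z$1)) (cnj (z$2)) - def_D t * cnj (z$3)]"

text \<open>\<open>def_J_lift t z\<close> is the endomorphism of the tangent space at \<open>z\<close> that the differential of
  the coordinate map \<open>def_zeta t\<close> turns into multiplication by \<open>\<i>\<close>, i.e. the almost-complex
  structure for which \<open>def_zeta t\<close> is a system of holomorphic coordinates.\<close>

definition def_J_lift :: "complex^2^3 \<Rightarrow> complex^3 \<Rightarrow> complex^3 \<Rightarrow> complex^3" where
  "def_J_lift t z v =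
     (THE w. frechet_derivative (def_zeta t) (at z) w
             = \<i> *s frechet_derivative (def_zeta t) (at z) v)"

text \<open>A tangent vector of the quotient is the set of its lifts, and \<open>def_J t\<close> is induced by
  \<open>def_J_lift t\<close> on all lifts simultaneously; see \<open>def_J_dproj\<close> below.\<close>

definition def_J ::
  "complex^2^3 \<Rightarrow> ((complex^3) \<times> (complex^3)) set \<Rightarrow> ((complex^3) \<times> (complex^3)) set" where
  "def_J t \<tau> = (\<lambda>(z, v). (z, def_J_lift t z v)) ` \<tau>"

lemma vector3_eq_iff: "(x::complex^3) = y \<longleftrightarrow> x$1 = y$1 \<and> x$2 = y$2 \<and> x$3 = y$3"
  by (simp add: vec_eq_iff forall_3)

lemma has_derivative_vector3:
  fixes f1 f2 f3 :: "'a::real_normed_vector \<Rightarrow> complex"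
  assumes "(f1 has_derivative f1') F" "(f2 has_derivative f2') F" "(f3 has_derivative f3') F"
  shows "((\<lambda>x. vector [f1 x, f2 x, f3 x] :: complex^3) has_derivative
           (\<lambda>h. vector [f1' h, f2' h, f3' h])) F"
proof -
  have lin: "bounded_linear (axis i :: complex \<Rightarrow> complex^3)" for i
    by (rule linear_conv_bounded_linear[THEN iffD1]) (rule linearI; simp add: vec_eq_iff axis_def)
  have eq: "(vector [a, b, c] :: complex^3) = axis 1 a + axis 2 b + axis 3 c" for a b c
    by (simp add: vector3_eq_iff axis_def)
  show ?thesis
    unfolding eq
    by (intro has_derivative_add bounded_linear.has_derivative[OF lin] assms)
qed

lemma has_derivative_nth:
  "((\<lambda>x::complex^3. x$i) has_derivative (\<lambda>h. h$i)) F"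
  by (rule bounded_linear.has_derivative[OF bounded_linear_vec_nth has_derivative_ident])

lemma has_derivative_cnj_nth:
  "((\<lambda>x::complex^3. cnj (x$i)) has_derivative (\<lambda>h. cnj (h$i))) F"
  by (rule bounded_linear.has_derivative[OF bounded_linear_cnj has_derivative_nth])

definition iw_dmult :: "complex^3 \<Rightarrow> complex^3 \<Rightarrow> complex^3" where
  "iw_dmult g v = vector [v$1, v$2, v$3 + g$1 * v$2]"

lemma frechet_derivative_iw_mult:
  "frechet_derivative (\<lambda>x. g \<star> x) (at z) = iw_dmult g"
proof -
  have "((\<lambda>x. g \<star> x) has_derivative iw_dmult g) (at z)"
    unfolding iw_mult_def iw_dmult_def[abs_def]
    by (rule has_derivative_vector3
          | rule has_derivative_eq_rhs,
            (rule derivative_intros has_derivative_nth)+, simp add: fun_eq_iff algebra_simps)+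
  then show ?thesis by (simp add: frechet_derivative_at[symmetric])
qed

lemma iw_dproj_altdef: "iw_dproj z v = (\<lambda>g. (g \<star> z, iw_dmult g v)) ` iw_lattice"
  by (simp add: iw_dproj_def frechet_derivative_iw_mult)

lemma zero_in_iw_lattice: "0 \<in> iw_lattice"
  by (simp add: iw_lattice_def gauss_int_def)

lemma iw_mult_zero_left: "0 \<star> z = z" and iw_dmult_zero: "iw_dmult 0 v = v"
  by (simp_all add: iw_mult_def iw_dmult_def vector3_eq_iff)

lemma iw_mult_free: "g \<star> z = z \<longleftrightarrow> g = 0"
  by (auto simp: iw_mult_def vector3_eq_iff)

lemma iw_dproj_inject: "iw_dproj z u = iw_dproj z v \<longleftrightarrow> u = v"
proof
  assume "iw_dproj z u = iw_dproj z v"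
  moreover have "(z, u) \<in> iw_dproj z u"
    unfolding iw_dproj_altdef
    by (rule image_eqI[OF _ zero_in_iw_lattice]) (simp add: iw_mult_zero_left iw_dmult_zero)
  ultimately obtain g where "z = g \<star> z" "u = iw_dmult g v"
    by (auto simp: iw_dproj_altdef)
  then show "u = v" by (metis iw_mult_free iw_dmult_zero)
qed simp

lemma iw_tangent_zero: "iw_tangent_zero (iw_proj z) = iw_dproj z 0"
  by (auto simp: iw_tangent_zero_def iw_dproj_altdef iw_proj_def iw_dmult_def vector3_eq_iff)

text \<open>For small \<open>t\<close> the coordinate map is an immersion, \<open>def_J_lift\<close> is well defined, and \<open>def_J\<close>
  descends to the quotient.\<close>

definition def_dzeta :: "complex^2^3 \<Rightarrow> complex^3 \<Rightarrow> complex^3 \<Rightarrow> complex^3" where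
  "def_dzeta t z v = vector
     [v$1 + (t$1$1 * cnj (v$1) + t$1$2 * cnj (v$2)),
      v$2 + (t$2$1 * cnj (v$1) + t$2$2 * cnj (v$2)),
      v$3 + ((t$3$1 + t$2$1 * z$1) * cnj (v$1) + t$2$1 * v$1 * cnj (z$1)
           + (t$3$2 + t$2$2 * z$1) * cnj (v$2) + t$2$2 * v$1 * cnj (z$2))
        + (t$1$1 * t$2$1 * (cnj (z$1) * cnj (v$1))
           + t$1$1 * t$2$2 * (cnj (z$1) * cnj (v$2) + cnj (z$2) * cnj (v$1))
           + t$1$2 * t$2$2 * (cnj (z$2) * cnj (v$2)))
        - def_D t * cnj (v$3)]"

lemma has_derivative_def_zeta: "(def_zeta t has_derivative def_dzeta t z) (at z)"
  unfolding def_zeta_def[abs_def] def_dzeta_def[abs_def] def_A_def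
  by (rule has_derivative_vector3
        | rule has_derivative_eq_rhs,
          (rule derivative_intros has_derivative_nth has_derivative_cnj_nth)+,
          simp add: fun_eq_iff algebra_simps)+

lemma frechet_derivative_def_zeta: "frechet_derivative (def_zeta t) (at z) = def_dzeta t z"
  using has_derivative_def_zeta by (simp add: frechet_derivative_at[symmetric])

lemma linear_def_dzeta: "linear (def_dzeta t z)"
  using has_derivative_def_zeta has_derivative_linear by blast

lemma def_dzeta_kernel:
  assumes t: "norm t < 1/4" and 0: "def_dzeta t z v = 0"
  shows "v = 0"
proof -
  have b: "norm (t$i$j) < 1/4" for i j
    using t Finite_Cartesian_Product.norm_nth_le[of t i] Finite_Cartesian_Product.norm_nth_le[of "t$i" j] by linarith
  have est: "norm a \<le> 1/4 * (norm x + norm y)"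
    if "a + (p * cnj x + q * cnj y) = 0" "norm p < 1/4" "norm q < 1/4" for a p q x y :: complex
  proof -
    have "a = - (p * cnj x + q * cnj y)" using that(1) by (rule iffD2[OF eq_neg_iff_add_eq_0])
    then have "norm a \<le> norm p * norm x + norm q * norm y"
      by (metis norm_minus_cancel norm_triangle_ineq norm_mult complex_mod_cnj)
    also have "\<dots> \<le> 1/4 * norm x + 1/4 * norm y"
      using that by (intro add_mono mult_right_mono) auto
    finally show ?thesis by simp
  qed
  have "v$1 + (t$1$1 * cnj (v$1) + t$1$2 * cnj (v$2)) = 0"
    "v$2 + (t$2$1 * cnj (v$1) + t$2$2 * cnj (v$2)) = 0"
    using 0 by (auto simp: def_dzeta_def vector3_eq_iff)
  from est[OF this(1) b b] est[OF this(2) b b]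
  have le: "3 * norm (v$1) \<le> norm (v$2)" "3 * norm (v$2) \<le> norm (v$1)"
    by simp_all
  have "norm (v$1) \<le> 0" using le norm_ge_zero[of "v$1"] by linarith
  moreover have "norm (v$2) \<le> 0" using le norm_ge_zero[of "v$2"] by linarith
  ultimately have v12: "v$1 = 0" "v$2 = 0" by simp_all
  have "norm (def_D t) \<le> norm (t$1$1) * norm (t$2$2) + norm (t$1$2) * norm (t$2$1)"
    unfolding def_D_def by (rule order_trans[OF norm_triangle_ineq4]) (simp add: norm_mult)
  also have "\<dots> \<le> 1/4 * (1/4) + 1/4 * (1/4)"
    by (intro add_mono mult_mono less_imp_le[OF b]) auto
  finally have D: "norm (def_D t) < 1/4" by simp
  have "v$3 + (- def_D t * cnj (v$3) + 0 * cnj 0) = 0"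
    using 0 v12 by (auto simp: def_dzeta_def vector3_eq_iff)
  then have "norm (v$3) \<le> 1/4 * (norm (v$3) + norm (0::complex))"
    by (rule est) (use D in auto)
  then have "v$3 = 0" by (simp flip: norm_le_zero_iff)
  with v12 show ?thesis by (simp add: vector3_eq_iff)
qed

lemma bij_def_dzeta: "norm t < 1/4 \<Longrightarrow> bij (def_dzeta t z)"
  using linear_injective_imp_surjective[OF linear_def_dzeta]
    linear_injective_0[OF linear_def_dzeta] def_dzeta_kernel
  by (metis bij_def)

lemma def_J_lift_iff:
  assumes "norm t < 1/4"
  shows "w = def_J_lift t z v \<longleftrightarrow> def_dzeta t z w = \<i> *s def_dzeta t z v"
proof -
  have ex1: "\<exists>!w. def_dzeta t z w = \<i> *s def_dzeta t z v"
    using bij_def_dzeta[OF assms] by (metis bij_pointE)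
  show ?thesis
    unfolding def_J_lift_def frechet_derivative_def_zeta
    using theI'[OF ex1] ex1 by blast
qed

lemma def_J_lift_equivariant:
  assumes "norm t < 1/4"
  shows "def_J_lift t (g \<star> z) (iw_dmult g v) = iw_dmult g (def_J_lift t z v)"
proof -
  define C where "C x = (vector [x$1, x$2, x$3 + g$1 * x$2
      + (t$2$1 * cnj (g$1) + t$2$2 * cnj (g$2)) * x$1] :: complex^3)" for x :: "complex^3"
  have C: "def_dzeta t (g \<star> z) (iw_dmult g u) = C (def_dzeta t z u)" for u
    by (simp add: C_def def_dzeta_def iw_dmult_def iw_mult_def vector3_eq_iff def_D_def algebra_simps)
  have "C (\<i> *s x) = \<i> *s C x" for x
    by (simp add: C_def vector3_eq_iff algebra_simps)
  then show ?thesis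
    using def_J_lift_iff[OF assms] by (metis C)
qed

lemma def_J_dproj:
  assumes "norm t < 1/4"
  shows "def_J t (iw_dproj z v) = iw_dproj z (def_J_lift t z v)"
  by (simp add: def_J_def iw_dproj_altdef image_image def_J_lift_equivariant[OF assms])

end

theory Submission
  imports Defs
begin

text \<open>For small \<open>t\<close> the lifted structure \<open>J\<close> maps the central vector \<open>e\<^sub>3 = \<partial>/\<partial>x\<^sup>3\<close> to a constant
  central vector \<open>W\<close>, so taming forces \<open>\<beta>(e\<^sub>3, W) > 0\<close> for the pullback \<open>\<beta>\<close> of \<open>\<omega>\<close>. But the torus
  swept out by the centre is null-homologous, because \<open>e\<^sub>3\<close> is a commutator. Concretely, on the
  slices \<open>z\<^sup>1 = s\<close>, \<open>Im z\<^sup>2 = 0\<close>, which are periodic in the remaining variables, closedness makes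
  \<open>G(s) = \<integral> \<beta>(e\<^sub>2, W)\<close> independent of \<open>s \<in> [0,1]\<close>: its derivative is the integral of
  \<open>\<partial>\<^sub>2 \<beta>(e\<^sub>1, W) - \<partial>\<^sub>W \<beta>(e\<^sub>1, e\<^sub>2)\<close>, derivatives of periodic functions. On the other hand the
  lattice element \<open>(1,0,0)\<close> maps the slice at \<open>0\<close> to the slice at \<open>1\<close>, and its differential maps
  \<open>e\<^sub>2 - e\<^sub>3\<close> to \<open>e\<^sub>2\<close>, whence \<open>G(1) = G(0) - \<integral> \<beta>(e\<^sub>3, W)\<close>. So the last integral vanishes.\<close>

section \<open>Integrals of periodic functions over the unit cube\<close>

text \<open>The translated cube is cut at height 1 in direction \<open>b\<close>. Its lower piece is
  the part of the unit cube above height \<open>s\<close>; its upper piece, moved back by the period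
  \<open>b\<close>, is the part below.\<close>

lemma integral_unit_cube_shift_periodic:
  fixes h :: "'a::euclidean_space \<Rightarrow> real"
  assumes cont: "continuous_on UNIV h" and b: "b \<in> Basis"
    and per: "\<And>y. h (y + b) = h y" and s: "0 \<le> s" "s \<le> 1"
  shows "integral (cbox 0 One) (\<lambda>y. h (y + s *\<^sub>R b)) = integral (cbox 0 One) h"
proof -
  let ?c = "s *\<^sub>R b"
  have int: "h integrable_on cbox u v" for u v
    by (rule integrable_continuous[OF continuous_on_subset[OF cont subset_UNIV]])
  have mem: "x \<in> cbox u v \<longleftrightarrow> u \<bullet> b \<le> x \<bullet> b \<and> x \<bullet> b \<le> v \<bullet> b \<and>
      (\<forall>i\<in>Basis - {b}. u \<bullet> i \<le> x \<bullet> i \<and> x \<bullet> i \<le> v \<bullet> i)" for x u v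
    using b by (auto simp: mem_box)
  have perp: "b \<bullet> i = 0" if "i \<in> Basis - {b}" for i
    using b that by (auto simp: inner_not_same_Basis)
  have bb: "b \<bullet> b = 1" using b by simp
  note coords = set_eq_iff mem inner_add_left inner_diff_left perp bb
  have low: "cbox ?c (One + ?c) \<inter> {x. x \<bullet> b \<le> 1} = cbox 0 One \<inter> {x. x \<bullet> b \<ge> s}"
    using b s by (auto simp: coords)
  have high: "cbox ?c (One + ?c) \<inter> {x. x \<bullet> b \<ge> 1} = cbox b (One + ?c)"
    using b s by (auto simp: coords)
  have low': "cbox 0 One \<inter> {x. x \<bullet> b \<le> s} = cbox 0 (One + ?c - b)"
    using b s by (auto simp: coords)
  have comp: "h \<circ> (+) b = h"
    using per by (auto simp: fun_eq_iff add.commute)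
  have "integral (cbox 0 One) (\<lambda>y. h (y + ?c)) = integral (cbox ?c (One + ?c)) h"
    using integral_shift_cbox_plus[of 0 One h ?c] by (simp add: o_def add.commute)
  also have "\<dots> = integral (cbox 0 One \<inter> {x. x \<bullet> b \<ge> s}) h + integral (cbox b (One + ?c)) h"
    by (subst integral_split[OF int b, of _ _ 1]) (simp add: low high)
  also have "integral (cbox b (One + ?c)) h = integral (cbox 0 One \<inter> {x. x \<bullet> b \<le> s}) h"
    using integral_shift_cbox_plus[of 0 "One + ?c - b" h b] by (simp add: low' comp)
  also have "integral (cbox 0 One \<inter> {x. x \<bullet> b \<ge> s}) h + \<dots> = integral (cbox 0 One) h"
    by (subst integral_split[OF int b, of _ _ s]) simp
  finally show ?thesis .
qed

lemma has_real_derivative_line: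
  fixes h h' :: "'a::real_normed_vector \<Rightarrow> real"
  assumes "\<And>y. ((\<lambda>s. h (y + s *\<^sub>R b)) has_real_derivative h' y) (at 0)"
  shows "((\<lambda>s. h (y + s *\<^sub>R b)) has_real_derivative h' (y + s *\<^sub>R b)) (at s)"
  using assms[of "y + s *\<^sub>R b"] DERIV_shift[of "\<lambda>r. h (y + r *\<^sub>R b)" _ 0 s]
  by (simp add: algebra_simps)

text \<open>The integral over the translated function \<open>?N\<close> is constant on [0,1] by
  periodicity, while differentiation under the integral sign at 0 gives the integral of
  \<open>h'\<close>. The derivative is one-sided because the shift lemma covers only [0,1].\<close>

lemma integral_unit_cube_derivative_periodic:
  fixes h h' :: "'a::euclidean_space \<Rightarrow> real"
  assumes cont: "continuous_on UNIV h" and cont': "continuous_on UNIV h'" and b: "b \<in> Basis"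
    and per: "\<And>y. h (y + b) = h y"
    and der: "\<And>y. ((\<lambda>s. h (y + s *\<^sub>R b)) has_real_derivative h' y) (at 0)"
  shows "integral (cbox 0 One) h' = 0"
proof -
  let ?N = "\<lambda>s. integral (cbox 0 One) (\<lambda>y. h (y + s *\<^sub>R b))"
  have "(?N has_real_derivative integral (cbox 0 One) (\<lambda>y. h' (y + 0 *\<^sub>R b))) (at 0 within {0..1})"
    by (rule leibniz_rule_field_derivative)
      (auto intro!: has_field_derivative_at_within[OF has_real_derivative_line[OF der]]
        integrable_continuous continuous_on_compose2[OF cont] continuous_on_compose2[OF cont']
        continuous_intros simp: case_prod_unfold)
  moreover have "(?N has_real_derivative 0) (at 0 within {0..1})"
    by (rule has_field_derivative_transform_within[OF DERIV_const[of "integral (cbox 0 One) h"], of 1])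
      (auto simp: integral_unit_cube_shift_periodic[OF cont b per])
  moreover have "at (0::real) within {0..1} \<noteq> bot"
    by (simp add: at_within_Icc_at_right)
  ultimately show ?thesis
    by (auto simp: has_field_derivative_iff dest: tendsto_unique)
qed

lemma One_prod: "(One :: 'a::euclidean_space \<times> 'b::euclidean_space) = (One, One)"
  by (simp add: sum_Basis_prod_eq sum_prod)

text \<open>By Fubini, the shear acts on each fibre over a fixed \<open>x\<close> as a translation
  in a periodic direction.\<close>

lemma integral_unit_cube_shear_periodic:
  fixes h :: "real \<times> 'a::euclidean_space \<Rightarrow> real"
  assumes cont: "continuous_on UNIV h" and b: "b \<in> Basis"
    and per: "\<And>x w. h (x, w + b) = h (x, w)"
  shows "integral (cbox 0 One) (\<lambda>(x, w). h (x, w - x *\<^sub>R b)) = integral (cbox 0 One) h"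
proof -
  have shift: "integral (cbox 0 One) (\<lambda>w. h (x, w - x *\<^sub>R b)) = integral (cbox 0 One) (\<lambda>w. h (x, w))"
    if "x \<in> cbox 0 1" for x
  proof -
    \<comment> \<open>Adding one period turns the shift by \<open>-x\<close> into one by
      \<open>1 - x\<close>, which lies in [0,1].\<close>
    have "h (x, w - x *\<^sub>R b) = h (x, w + (1 - x) *\<^sub>R b)" for w
      using per[of x "w - x *\<^sub>R b"] by (simp add: algebra_simps)
    then show ?thesis
      using that
      by (simp, intro integral_unit_cube_shift_periodic)
        (auto intro!: continuous_on_compose2[OF cont] continuous_intros b simp: per)
  qed
  have "integral (cbox 0 One) (\<lambda>(x, w). h (x, w - x *\<^sub>R b))
      = integral (cbox 0 1) (\<lambda>x. integral (cbox 0 One) (\<lambda>w. h (x, w - x *\<^sub>R b)))"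
    unfolding One_prod zero_prod_def
    by (subst integral_prod_continuous)
      (auto intro!: continuous_on_compose2[OF cont] continuous_intros simp: case_prod_unfold)
  also have "\<dots> = integral (cbox 0 1) (\<lambda>x. integral (cbox 0 One) (\<lambda>w. h (x, w)))"
    by (rule integral_cong) (rule shift)
  also have "\<dots> = integral (cbox 0 One) h"
    unfolding One_prod zero_prod_def
    by (subst integral_prod_continuous) (auto intro: continuous_on_subset[OF cont])
  finally show ?thesis .
qed

section \<open>The lattice action on points and tangent vectors\<close>

lemma iw_mult_assoc: "(g \<star> h) \<star> z = g \<star> (h \<star> z)"
  by (simp add: iw_mult_def vector3_eq_iff algebra_simps)

lemma iw_dmult_mult: "iw_dmult (g \<star> h) v = iw_dmult g (iw_dmult h v)"
  by (simp add: iw_mult_def iw_dmult_def vector3_eq_iff algebra_simps)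

lemma iw_lattice_mult_right:
  assumes "g \<in> iw_lattice"
  shows "(\<lambda>h. h \<star> g) ` iw_lattice = iw_lattice"
proof (intro equalityI subsetI)
  fix k assume "k \<in> (\<lambda>h. h \<star> g) ` iw_lattice"
  then show "k \<in> iw_lattice"
    using assms by (auto simp: iw_lattice_def gauss_int_def iw_mult_def forall_3)
next
  fix k assume k: "k \<in> iw_lattice"
  \<comment> \<open>This is the product of \<open>k\<close> with the group inverse of
    \<open>g\<close>.\<close>
  define h :: "complex^3" where "h = vector [k$1 - g$1, k$2 - g$2, k$3 - g$3 - (k$1 - g$1) * g$2]"
  have "h \<in> iw_lattice"
    using assms k by (auto simp: h_def iw_lattice_def gauss_int_def forall_3)
  moreover have "k = h \<star> g"
    by (simp add: h_def iw_mult_def vector3_eq_iff)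
  ultimately show "k \<in> (\<lambda>h. h \<star> g) ` iw_lattice" by blast
qed

text \<open>Right multiplication by \<open>g\<close> permutes the lattice, so it only reindexes the
  orbits that represent points and tangent vectors of the quotient.\<close>

lemma iw_pullback_lattice:
  assumes "g \<in> iw_lattice"
  shows "iw_pullback \<omega> (g \<star> z) (iw_dmult g u) (iw_dmult g v) = iw_pullback \<omega> z u v"
proof -
  have "iw_proj (g \<star> z) = iw_proj z"
    unfolding iw_proj_def
    by (subst (2) iw_lattice_mult_right[OF assms, symmetric]) (simp add: image_image iw_mult_assoc)
  moreover have "iw_dproj (g \<star> z) (iw_dmult g v) = iw_dproj z v" for v
    unfolding iw_dproj_altdef
    by (subst (2) iw_lattice_mult_right[OF assms, symmetric])
      (simp add: image_image iw_mult_assoc iw_dmult_mult)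
  ultimately show ?thesis by (simp add: iw_pullback_def)
qed

section \<open>Slices on which the pullback is periodic\<close>

text \<open>The parameter space is a product whose \<open>Basis\<close> gives the periods of the
  slice and whose real factor can be split off for the shear.\<close>

definition iw_slice :: "real \<Rightarrow> real \<times> complex \<Rightarrow> complex^3" where
  "iw_slice s y = vector [of_real s, of_real (fst y), snd y]"

lemma iw_slice_eq: "iw_slice s y = s *\<^sub>R axis 1 1 + fst y *\<^sub>R axis 2 1 + axis 3 (snd y)"
  by (simp add: iw_slice_def vector3_eq_iff axis_def scaleR_conv_of_real[where 'a=complex])

lemma iw_slice_add:
  "iw_slice s y + r *\<^sub>R axis 1 1 = iw_slice (s + r) y"
  "iw_slice s y + r *\<^sub>R axis 2 1 = iw_slice s (y + r *\<^sub>R (1, 0))"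
  "iw_slice s y + r *\<^sub>R axis 3 w = iw_slice s (y + r *\<^sub>R (0, w))"
  by (simp_all add: iw_slice_def vector3_eq_iff axis_def scaleR_conv_of_real[where 'a=complex])

lemma continuous_on_iw_slice [continuous_intros]:
  assumes "continuous_on S f" "continuous_on S g"
  shows "continuous_on S (\<lambda>x. iw_slice (f x) (g x))"
proof -
  have "linear (axis 3 :: complex \<Rightarrow> complex^3)"
    by (rule linearI) (simp_all add: vec_eq_iff axis_def)
  then have "bounded_linear (axis 3 :: complex \<Rightarrow> complex^3)"
    by (simp add: linear_conv_bounded_linear)
  then show ?thesis
    unfolding iw_slice_eq
    by (intro continuous_intros assms bounded_linear.continuous_on[of "axis 3"])
qed

text \<open>Adding \<open>b\<close> is left translation by a lattice element with first coordinate
  0, whose differential is the identity.\<close>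

lemma iw_slice_periodic:
  assumes "b \<in> Basis"
  shows "iw_pullback \<omega> (iw_slice s (y + b)) u v = iw_pullback \<omega> (iw_slice s y) u v"
proof -
  obtain g where g: "g \<in> iw_lattice" "g$1 = 0" "iw_slice s (y + b) = g \<star> iw_slice s y"
  proof
    let ?g = "iw_slice 0 b"
    show "?g \<in> iw_lattice"
      using assms
      by (auto simp: Basis_prod_def Basis_complex_def iw_slice_def iw_lattice_def gauss_int_def forall_3)
    show "?g$1 = 0" "iw_slice s (y + b) = ?g \<star> iw_slice s y"
      by (simp_all add: iw_slice_def iw_mult_def vector3_eq_iff add.commute)
  qed
  have "iw_dmult g u = u" for u
    by (simp add: iw_dmult_def vector3_eq_iff g(2))
  then show ?thesis using iw_pullback_lattice[OF g(1)] g(3) by metis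
qed

lemma smooth_directional_derivative:
  assumes "smooth f"
  shows "((\<lambda>r. f (z + r *\<^sub>R v)) has_real_derivative frechet_derivative f (at z) v) (at 0)"
    and "continuous_on UNIV (\<lambda>x. frechet_derivative f (at x) v)"
    and "continuous_on UNIV f"
proof -
  have "Ck (Suc 0) f" "Ck 0 f" using assms unfolding smooth_def by blast+
  then have diff: "\<And>x. f differentiable (at x)"
    and "continuous_on UNIV (\<lambda>x. frechet_derivative f (at x) v)" "continuous_on UNIV f"
    by simp_all
  then show "continuous_on UNIV (\<lambda>x. frechet_derivative f (at x) v)" "continuous_on UNIV f"
    by blast+
  have D: "(f has_derivative frechet_derivative f (at z)) (at z)"
    using diff frechet_derivative_works by blast
  have "((\<lambda>r. f (z + r *\<^sub>R v)) has_derivative (\<lambda>r. frechet_derivative f (at z) (r *\<^sub>R v))) (at 0)"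
    by (rule has_derivative_compose[of "\<lambda>r. z + r *\<^sub>R v" _ _ _ f "frechet_derivative f (at z)"])
      (use D in \<open>auto intro!: derivative_eq_intros\<close>)
  moreover have "frechet_derivative f (at z) (r *\<^sub>R v) = frechet_derivative f (at z) v * r" for r
    using has_derivative_linear[OF D] by (simp add: linear_cmul)
  ultimately show "((\<lambda>r. f (z + r *\<^sub>R v)) has_real_derivative frechet_derivative f (at z) v) (at 0)"
    by (simp add: has_field_derivative_def)
qed

text \<open>The allowed directions \<open>d\<close> are tangent to the slice and correspond to basis
  vectors of the cube, so the integrand is a derivative of a periodic function along a
  period.\<close>

lemma integral_slice_derivative:
  assumes smooth: "smooth (\<lambda>z. iw_pullback \<omega> z u v)" and d: "d \<in> {axis 2 1, axis 3 1, axis 3 \<i>}"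
  shows "integral (cbox 0 One)
    (\<lambda>y. frechet_derivative (\<lambda>z. iw_pullback \<omega> z u v) (at (iw_slice s y)) d) = 0"
proof -
  obtain b where b: "b \<in> Basis" "\<And>y r. iw_slice s (y + r *\<^sub>R b) = iw_slice s y + r *\<^sub>R d"
  proof -
    consider "d = axis 2 1" | "d = axis 3 1" | "d = axis 3 \<i>" using d by blast
    then show thesis
      by cases (rule that[of "(1, 0)"] that[of "(0, 1)"] that[of "(0, \<i>)"],
        simp_all add: iw_slice_add Basis_prod_def Basis_complex_def; fail)+
  qed
  note sm = smooth_directional_derivative[OF smooth]
  show ?thesis
    by (rule integral_unit_cube_derivative_periodic[OF _ _ b(1), of "\<lambda>y. iw_pullback \<omega> (iw_slice s y) u v"])
      (auto intro!: continuous_on_compose2[OF sm(3)] continuous_on_compose2[OF sm(2)]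
        continuous_intros iw_slice_periodic b(1) sm(1) simp: b(2))
qed

lemma integral_slice_central:
  assumes sm: "iw_smooth_form2 \<omega>" and cl: "iw_closed \<omega>"
  shows "integral (cbox 0 One) (\<lambda>y. iw_pullback \<omega> (iw_slice 0 y) (axis 3 1) (axis 3 w)) = 0"
proof -
  let ?\<beta> = "iw_pullback \<omega>" and ?e1 = "axis 1 1 :: complex^3" and ?e2 = "axis 2 1 :: complex^3"
    and ?e3 = "axis 3 1 :: complex^3" and ?W = "axis 3 w :: complex^3" and ?Q = "cbox 0 One"
  define D where "D u v z d = frechet_derivative (\<lambda>z. ?\<beta> z u v) (at z) d" for u v z d
  define G where "G s = integral ?Q (\<lambda>y. ?\<beta> (iw_slice s y) ?e2 ?W)" for s
  have smooth: "\<And>u v. smooth (\<lambda>z. ?\<beta> z u v)"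
    and bil: "\<And>z. bilinear (?\<beta> z)"
    using sm by (auto simp: iw_smooth_form2_def)
  note sd = smooth_directional_derivative[OF smooth, folded D_def]
  have cD: "continuous_on S (\<lambda>y. D u v (iw_slice s y) d)" for S u v s d
    by (auto intro!: continuous_on_compose2[OF sd(2)] continuous_intros)
  have cB: "continuous_on S (\<lambda>y. ?\<beta> (iw_slice s y) u v)" for S u v s
    by (auto intro!: continuous_on_compose2[OF sd(3)] continuous_intros)
  have zero: "integral ?Q (\<lambda>y. D u v (iw_slice s y) d) = 0"
    if "d \<in> {axis 2 1, axis 3 1, axis 3 \<i>}" for u v s d
    using integral_slice_derivative[OF smooth that] by (simp add: D_def)
  \<comment> \<open>\<open>?W\<close> need not be a period; real linearity reduces it to the two
    central directions that are.\<close>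
  have DW: "D ?e1 ?e2 z ?W = Re w * D ?e1 ?e2 z (axis 3 1) + Im w * D ?e1 ?e2 z (axis 3 \<i>)" for z
  proof -
    have "Ck (Suc 0) (\<lambda>z. ?\<beta> z ?e1 ?e2)" using smooth unfolding smooth_def by blast
    then have "linear (D ?e1 ?e2 z)"
      by (simp add: D_def[abs_def] linear_frechet_derivative)
    moreover have "?W = Re w *\<^sub>R axis 3 1 + Im w *\<^sub>R axis 3 \<i>"
      by (simp add: vector3_eq_iff axis_def complex_eq_iff)
    ultimately show ?thesis by (simp add: linear_add linear_cmul)
  qed
  have zeroW: "integral ?Q (\<lambda>y. D ?e1 ?e2 (iw_slice s y) ?W) = 0" for s
    unfolding DW
    by (subst integral_add) (auto intro!: integrable_continuous continuous_intros cD simp: zero)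
  \<comment> \<open>Closedness on \<open>?e1\<close>, \<open>?e2\<close>, \<open>?W\<close> trades
    the derivative transverse to the slice for derivatives along it.\<close>
  have "D ?e2 ?W z ?e1 = D ?e1 ?W z ?e2 - D ?e1 ?e2 z ?W" for z
    using cl by (simp add: iw_closed_def ext_deriv2_def D_def algebra_simps)
  then have zero1: "integral ?Q (\<lambda>y. D ?e2 ?W (iw_slice s y) ?e1) = 0" for s
    by (simp, subst integral_diff) (auto intro!: integrable_continuous cD simp: zero zeroW)
  have "(G has_real_derivative 0) (at s within {0..1})" if "s \<in> {0..1}" for s
  proof -
    have der: "((\<lambda>s. ?\<beta> (iw_slice s y) ?e2 ?W) has_real_derivative D ?e2 ?W (iw_slice s y) ?e1)
        (at s within {0..1})" for s y
      using has_real_derivative_line[where h = "\<lambda>z. ?\<beta> z ?e2 ?W" and h' = "\<lambda>z. D ?e2 ?W z ?e1",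
          OF sd(1), of "iw_slice 0 y" s]
      by (auto simp: iw_slice_add intro: has_field_derivative_at_within)
    have "(G has_real_derivative integral ?Q (\<lambda>y. D ?e2 ?W (iw_slice s y) ?e1)) (at s within {0..1})"
      unfolding G_def
      by (rule leibniz_rule_field_derivative)
        (use that in \<open>auto intro!: der integrable_continuous cB continuous_on_compose2[OF sd(2)]
          continuous_intros simp: case_prod_unfold\<close>)
    then show ?thesis by (simp add: zero1)
  qed
  then have "\<exists>c. \<forall>s\<in>{0..1}. G s = c"
    by (intro has_field_derivative_zero_constant) auto
  then have G01: "G 1 = G 0" by auto
  \<comment> \<open>\<open>k\<close> is the integrand of \<open>G 1\<close> carried back to the
    slice at 0 by the lattice element \<open>?e1\<close>, which shears the slice by
    \<open>x\<close>.\<close>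
  define k where "k y = ?\<beta> (iw_slice 0 y) (?e2 - ?e3) ?W" for y
  have shear: "?\<beta> (iw_slice 1 (x, z)) ?e2 ?W = k (x, z - x *\<^sub>R 1)" for x z
  proof -
    have "?e1 \<in> iw_lattice"
      by (auto simp: iw_lattice_def gauss_int_def axis_def)
    moreover have "?e1 \<star> iw_slice 0 (x, z - x *\<^sub>R 1) = iw_slice 1 (x, z)"
      "iw_dmult ?e1 (?e2 - ?e3) = ?e2" "iw_dmult ?e1 ?W = ?W"
      by (simp_all add: iw_slice_def iw_mult_def iw_dmult_def vector3_eq_iff axis_def
          scaleR_conv_of_real[where 'a=complex])
    ultimately show ?thesis unfolding k_def by (metis iw_pullback_lattice)
  qed
  have "G 1 = integral ?Q (\<lambda>(x, z). k (x, z - x *\<^sub>R 1))"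
    by (simp add: G_def case_prod_unfold flip: shear)
  also have "\<dots> = integral ?Q k"
  proof (rule integral_unit_cube_shear_periodic)
    show "k (x, z + 1) = k (x, z)" for x z
      using iw_slice_periodic[of "(0, 1)" \<omega> 0 "(x, z)"]
      by (simp add: k_def Basis_prod_def Basis_complex_def)
  qed (auto simp: k_def[abs_def] cB Basis_complex_def)
  also have "k = (\<lambda>y. ?\<beta> (iw_slice 0 y) ?e2 ?W - ?\<beta> (iw_slice 0 y) ?e3 ?W)"
    by (simp add: k_def[abs_def] bilinear_lsub[OF bil])
  also have "integral ?Q \<dots> = G 0 - integral ?Q (\<lambda>y. ?\<beta> (iw_slice 0 y) ?e3 ?W)"
    unfolding G_def by (intro integral_diff integrable_continuous cB)
  finally show ?thesis using G01 by simp
qed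

section \<open>The central direction and taming\<close>

text \<open>On central vectors \<open>def_dzeta t z\<close> acts as \<open>?f\<close>, independently
  of \<open>z\<close>. As a restriction of an injective map, \<open>?f\<close> is injective, hence
  bijective, and \<open>w\<close> solves the defining equation of the lift inside the
  centre.\<close>

lemma def_J_lift_central:
  assumes t: "norm t < 1/4"
  obtains w where "\<And>z. def_J_lift t z (axis 3 1) = axis 3 w"
proof -
  let ?f = "\<lambda>v. v - def_D t * cnj v"
  have lin: "linear ?f"
    by (rule linearI) (simp_all add: algebra_simps)
  have dz: "def_dzeta t z (axis 3 v) = axis 3 (?f v)" for z v
    by (simp add: def_dzeta_def vector3_eq_iff axis_def)
  have "v = 0" if "?f v = 0" for v
  proof -
    have "def_dzeta t 0 (axis 3 v) = 0" unfolding dz that by (simp add: axis_eq_0_iff)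
    then show ?thesis using def_dzeta_kernel[OF t] by (metis axis_eq_0_iff)
  qed
  then have "inj ?f" using linear_injective_0[OF lin] by blast
  then have "surj ?f" using linear_injective_imp_surjective[OF lin] by blast
  then obtain w where w: "\<i> * ?f 1 = ?f w" by (rule surjE)
  have "axis 3 w = def_J_lift t z (axis 3 1)" for z
    unfolding def_J_lift_iff[OF t] dz w[symmetric] by (simp add: vector3_eq_iff axis_def)
  then show thesis by (metis that)
qed

theorem theorem3p6:
  shows "\<exists>\<epsilon>>0. \<forall>t::complex^2^3. norm t < \<epsilon> \<longrightarrow>
           (\<forall>\<omega>. iw_symplectic \<omega> \<longrightarrow> \<not> iw_tamed \<omega> (def_J t))"
\<comment> \<open>The radius 1/4 is the bound under which \<open>def_dzeta\<close> is shown to be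
  bijective and \<open>def_J\<close> to descend.\<close>
proof (intro exI[of _ "1/4"] conjI allI impI notI)
  fix t :: "complex^2^3" and \<omega>
  assume t: "norm t < 1/4" and symp: "iw_symplectic \<omega>" and tamed: "iw_tamed \<omega> (def_J t)"
  have sm: "iw_smooth_form2 \<omega>" and cl: "iw_closed \<omega>"
    using symp by (auto simp: iw_symplectic_def)
  obtain w where w: "\<And>z. def_J_lift t z (axis 3 1) = axis 3 w"
    using def_J_lift_central[OF t] by blast
  have pos: "iw_pullback \<omega> z (axis 3 1) (axis 3 w) > 0" for z
  proof -
    have "iw_dproj z (axis 3 1) \<noteq> iw_tangent_zero (iw_proj z)"
      by (simp add: iw_tangent_zero iw_dproj_inject axis_eq_0_iff)
    moreover have "iw_proj z \<in> iwasawa" "iw_dproj z (axis 3 1) \<in> iw_tangent (iw_proj z)"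
      by (auto simp: iwasawa_def iw_tangent_def)
    ultimately show ?thesis
      using tamed by (force simp: iw_tamed_def iw_pullback_def def_J_dproj[OF t] w)
  qed
  let ?f = "\<lambda>y. iw_pullback \<omega> (iw_slice 0 y) (axis 3 1) (axis 3 w)"
  have "smooth (\<lambda>z. iw_pullback \<omega> z (axis 3 1) (axis 3 w))"
    using sm by (simp add: iw_smooth_form2_def)
  from smooth_directional_derivative(3)[OF this] have "continuous_on (cbox 0 One) ?f"
    by (rule continuous_on_compose2) (auto intro!: continuous_intros)
  \<comment> \<open>A continuous nonnegative function with zero integral vanishes on the cube, which
    contradicts \<open>pos\<close> at the origin.\<close>
  then have "integral (cbox 0 One) ?f = 0 \<longleftrightarrow> (\<forall>y\<in>cbox 0 One. ?f y = 0)"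
    by (rule integral_cbox_eq_0_iff) (auto simp: box_ne_empty intro: less_imp_le[OF pos])
  then have "?f 0 = 0"
    using integral_slice_central[OF sm cl, of w] by (auto simp: mem_box)
  then show False using pos[of "iw_slice 0 0"] by simp
qed simp

end
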